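(* For all integers $n \geq 2$ and $k \geq 3$, the map $T_k$ restricts to bijections of the spaces of $k$-spirals of each type: $T_k(\mathcal{S}_{k,n}^\alpha) = \mathcal{S}_{k,n}^\alpha$ and $T_k(\mathcal{S}_{k,n}^\beta) = \mathcal{S}_{k,n}^\beta$. Equivalently, both $T_k$ and $T_k^{-1}$ map $\mathcal{S}_{k,n}^\alpha$ into $\mathcal{S}_{k,n}^\alpha$ and $\mathcal{S}_{k,n}^\beta$ into $\mathcal{S}_{k,n}^\beta$.
   Context: The affine patch $\mathbb{A}^2=\{[x:y:1]\}\subset\mathbb{RP}^2$ is identified with $\mathbb{R}^2$ via $(x,y)\mapsto[x:y:1]$. For $V_1,V_2,V_3\in\mathbb{A}^2$ with affine coordinates $\tilde V_j=(x_j,y_j,1)$, set $\mathcal{O}(V_1,V_2,V_3)=\det(\tilde V_1,\tilde V_2,\tilde V_3)$ (the $3\times3$ matrix with these columns); the ordered triple $(V_1,V_2,V_3)$ is called positive if $\mathcal{O}(V_1,V_2,V_3)>0$. $\operatorname{int}(V_1,V_2,V_3)$ denotes the interior of the affine triangle with vertices $V_1,V_2,V_3$. A twisted $n$-gon is a map $P:\mathbb{Z}\to\mathbb{RP}^2$ such that every three consecutive points $P_i,P_{i+1},P_{i+2}$ are not collinear, together with a projective transformation $M\in\mathrm{PGL}_3(\mathbb{R})$ (the monodromy) with $P_{i+n}=M(P_i)$ for all $i$. Two twisted $n$-gons $P,Q$ are equivalent if there is $\phi\in\mathrm{PGL}_3(\mathbb{R})$ with $\phi(P_i)=Q_i$ for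 all $i$; $\mathcal{P}_n$ is the set of equivalence classes $[P]$. $P$ is $k$-nice if for every $i$ the four points $P_i,P_{i+1},P_{i+k},P_{i+k+1}$ are in general position (no three collinear); this is invariant under equivalence. For $k\ge3$, a class $[P]\in\mathcal{P}_n$ is a $k$-spiral of type $\alpha$ (resp. type $\beta$) if it is $k$-nice and for every $N\in\mathbb{Z}$ there exists a representative $P$ such that for all $i\ge N$: $P_i\in\mathbb{A}^2$, $(P_i,P_{i+1},P_{i+2})$ is positive, and for type $\alpha$: $(P_i,P_{i+1},P_{i+k+1})$ is positive and $P_{i+k}\in\operatorname{int}(P_i,P_{i+1},P_{i+k+1})$; for type $\beta$: $(P_i,P_{i+1},P_{i+k})$ is positive and $P_{i+k+1}\in\operatorname{int}(P_i,P_{i+1},P_{i+k})$. Such a $P$ is called an $N$-representative of type $\alpha$ (resp. $\beta$). $\mathcal{S}_{k,n}^\alpha$, $\mathcal{S}_{k,n}^\beta$ denote the sets of $k$-spirals of type $\alpha$, $\beta$. For a $k$-nice twisted $n$-gon $P$, $T_k(P)=P'$ is defined by $P'_i = P_iP_{i+k}\cap P_{i+1}P_{i+k+1}$ (intersection of the lines through the indicated points); $P'$ is again a $k$-nice twisted $n$-gon, $T_k$ commutes with projective transformations and so acts on classes of $k$-nice twisted $n$-gons, with inverse given by $P_i=P'_{i-k-1}P'_{i-k}\cap P'_{i-1}P'_i$. *)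

theory Defs
  imports "HOL-Analysis.Analysis"
begin

text \<open>Points of RP^2 are represented by nonzero homogeneous coordinate vectors in real^3;
  two vectors represent the same point iff they are proportional.\<close>

definition proj_eq :: "real^3 \<Rightarrow> real^3 \<Rightarrow> bool" where
  "proj_eq u v \<longleftrightarrow> (\<exists>c. c \<noteq> 0 \<and> u = c *\<^sub>R v)"

definition collinear3 :: "real^3 \<Rightarrow> real^3 \<Rightarrow> real^3 \<Rightarrow> bool" where
  "collinear3 u v w \<longleftrightarrow> det (vector [u, v, w] :: real^3^3) = 0"

definition join :: "real^3 \<Rightarrow> real^3 \<Rightarrow> real^3" where
  "join u v = cross3 u v"
definition meet :: "real^3 \<Rightarrow> real^3 \<Rightarrow> real^3" where
  "meet l m = cross3 l m"

definition twisted_ngon :: "nat \<Rightarrow> (int \<Rightarrow> real^3) \<Rightarrow> bool" where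
  "twisted_ngon n P \<longleftrightarrow>
     (\<forall>i. P i \<noteq> 0) \<and>
     (\<forall>i. \<not> collinear3 (P i) (P (i+1)) (P (i+2))) \<and>
     (\<exists>M :: real^3^3. invertible M \<and> (\<forall>i. proj_eq (P (i + int n)) (M *v P i)))"

definition proj_equiv :: "(int \<Rightarrow> real^3) \<Rightarrow> (int \<Rightarrow> real^3) \<Rightarrow> bool" where
  "proj_equiv P Q \<longleftrightarrow> (\<exists>\<phi> :: real^3^3. invertible \<phi> \<and> (\<forall>i. proj_eq (Q i) (\<phi> *v P i)))"

definition gen_pos4 :: "real^3 \<Rightarrow> real^3 \<Rightarrow> real^3 \<Rightarrow> real^3 \<Rightarrow> bool" where
  "gen_pos4 a b c d \<longleftrightarrow>
     \<not> collinear3 a b c \<and> \<not> collinear3 a b d \<and> \<not> collinear3 a c d \<and> \<not> collinear3 b c d"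

definition k_nice :: "nat \<Rightarrow> (int \<Rightarrow> real^3) \<Rightarrow> bool" where
  "k_nice k P \<longleftrightarrow>
     (\<forall>i. gen_pos4 (P i) (P (i+1)) (P (i + int k)) (P (i + int k + 1)))"

definition Tk :: "nat \<Rightarrow> (int \<Rightarrow> real^3) \<Rightarrow> (int \<Rightarrow> real^3)" where
  "Tk k P = (\<lambda>i. meet (join (P i) (P (i + int k))) (join (P (i+1)) (P (i + int k + 1))))"

definition Tk_inv :: "nat \<Rightarrow> (int \<Rightarrow> real^3) \<Rightarrow> (int \<Rightarrow> real^3)" where
  "Tk_inv k P' = (\<lambda>i. meet (join (P' (i - int k - 1)) (P' (i - int k))) (join (P' (i - 1)) (P' i)))"

definition in_affine :: "real^3 \<Rightarrow> bool" where
  "in_affine v \<longleftrightarrow> v $ 3 \<noteq> 0"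

definition aff :: "real^3 \<Rightarrow> real^2" where
  "aff v = vector [v $ 1 / v $ 3, v $ 2 / v $ 3]"

definition lift :: "real^2 \<Rightarrow> real^3" where
  "lift a = vector [a $ 1, a $ 2, 1]"

definition orient :: "real^3 \<Rightarrow> real^3 \<Rightarrow> real^3 \<Rightarrow> real" where
  "orient u v w = det (transpose (vector [lift (aff u), lift (aff v), lift (aff w)] :: real^3^3))"

definition positive3 :: "real^3 \<Rightarrow> real^3 \<Rightarrow> real^3 \<Rightarrow> bool" where
  "positive3 u v w \<longleftrightarrow> orient u v w > 0"

definition in_triangle :: "real^3 \<Rightarrow> real^3 \<Rightarrow> real^3 \<Rightarrow> real^3 \<Rightarrow> bool" where
  "in_triangle x a b c \<longleftrightarrow> aff x \<in> interior (convex hull {aff a, aff b, aff c})"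

definition N_rep_alpha :: "nat \<Rightarrow> int \<Rightarrow> (int \<Rightarrow> real^3) \<Rightarrow> bool" where
  "N_rep_alpha k N Q \<longleftrightarrow>
     (\<forall>i\<ge>N. in_affine (Q i) \<and> positive3 (Q i) (Q (i+1)) (Q (i+2)) \<and>
        positive3 (Q i) (Q (i+1)) (Q (i + int k + 1)) \<and>
        in_triangle (Q (i + int k)) (Q i) (Q (i+1)) (Q (i + int k + 1)))"

definition N_rep_beta :: "nat \<Rightarrow> int \<Rightarrow> (int \<Rightarrow> real^3) \<Rightarrow> bool" where
  "N_rep_beta k N Q \<longleftrightarrow>
     (\<forall>i\<ge>N. in_affine (Q i) \<and> positive3 (Q i) (Q (i+1)) (Q (i+2)) \<and>
        positive3 (Q i) (Q (i+1)) (Q (i + int k)) \<and>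
        in_triangle (Q (i + int k + 1)) (Q i) (Q (i+1)) (Q (i + int k)))"

text \<open>k-spirals of type alpha / beta (a property of the class of P, stated on a representative).\<close>
definition spiral_alpha :: "nat \<Rightarrow> nat \<Rightarrow> (int \<Rightarrow> real^3) \<Rightarrow> bool" where
  "spiral_alpha k n P \<longleftrightarrow> twisted_ngon n P \<and> k_nice k P \<and>
     (\<forall>N. \<exists>Q. proj_equiv P Q \<and> N_rep_alpha k N Q)"

definition spiral_beta :: "nat \<Rightarrow> nat \<Rightarrow> (int \<Rightarrow> real^3) \<Rightarrow> bool" where
  "spiral_beta k n P \<longleftrightarrow> twisted_ngon n P \<and> k_nice k P \<and>
     (\<forall>N. \<exists>Q. proj_equiv P Q \<and> N_rep_beta k N Q)"

end

theory Submission
  imports Defs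
begin

text \<open>
  On homogeneous vectors with positive last coordinate both spiral types become sign conditions on
  five determinants per index. The vertices of \<open>T\<^sub>k P\<close> and of \<open>T\<^sub>k\<^sup>-\<^sup>1 P\<close> can each be written in
  two ways as explicit combinations of two vertices of \<open>P\<close>, with these determinants as
  coefficients. Two vertices of \<open>T\<^sub>k P\<close> with consecutive indices span a line
  \<open>P\<^sub>i\<^sub>+\<^sub>1 P\<^sub>i\<^sub>+\<^sub>k\<^sub>+\<^sub>1\<close>, and two vertices of \<open>T\<^sub>k\<^sup>-\<^sup>1 P\<close> with indices differing by \<open>k\<close> span an
  edge line of \<open>P\<close>; so every determinant of the image reduces to determinants of \<open>P\<close>. The one that
  is not given, \<open>det (P\<^sub>i, P\<^sub>i\<^sub>+\<^sub>k, P\<^sub>i\<^sub>+\<^sub>2\<^sub>k)\<close>, has its sign forced by a Pluecker relation.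
  Hence \<open>N\<close>-representatives are mapped to \<open>N\<close>-representatives (up to an index shift), and
  equivariance does the rest.
\<close>

section \<open>Brackets and intersections of lines in homogeneous coordinates\<close>

unbundle cross3_syntax

text \<open>The determinant with rows \<open>u\<close>, \<open>v\<close>, \<open>w\<close>, as a
  triple product. Unlike \<open>orient\<close> it is taken on unnormalized vectors and so stays
  linear in each argument.\<close>

definition bracket :: "real^3 \<Rightarrow> real^3 \<Rightarrow> real^3 \<Rightarrow> real" where
  "bracket u v w = u \<bullet> (v \<times> w)"

lemma bracket_expand:
  "bracket u v w = u$1 * (v$2 * w$3 - v$3 * w$2) + u$2 * (v$3 * w$1 - v$1 * w$3)
     + u$3 * (v$1 * w$2 - v$2 * w$1)"
  by (simp add: bracket_def cross3_def inner_vec_def sum_3)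

lemma bracket_linear [simp]:
  "bracket (u + u') v w = bracket u v w + bracket u' v w"
  "bracket u (v + v') w = bracket u v w + bracket u v' w"
  "bracket u v (w + w') = bracket u v w + bracket u v w'"
  "bracket (u - u') v w = bracket u v w - bracket u' v w"
  "bracket u (v - v') w = bracket u v w - bracket u v' w"
  "bracket u v (w - w') = bracket u v w - bracket u v w'"
  "bracket (c *\<^sub>R u) v w = c * bracket u v w"
  "bracket u (c *\<^sub>R v) w = c * bracket u v w"
  "bracket u v (c *\<^sub>R w) = c * bracket u v w"
  by (simp_all add: bracket_expand algebra_simps)

lemma bracket_same [simp]: "bracket u u v = 0" "bracket u v u = 0" "bracket v u u = 0"
  by (simp_all add: bracket_expand algebra_simps)

lemma bracket_rotate: "bracket u v w = bracket v w u"
  by (simp add: bracket_expand algebra_simps)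

lemma bracket_swap: "bracket u v w = - bracket v u w" "bracket u v w = - bracket u w v"
  by (simp_all add: bracket_expand algebra_simps)

lemma collinear3_bracket: "collinear3 u v w \<longleftrightarrow> bracket u v w = 0"
  by (simp add: collinear3_def bracket_def dot_cross_det)

text \<open>The double cross product expands along either pair: the intersection lies on both lines,
  hence is a combination of \<open>a\<close>, \<open>b\<close> and also of \<open>c\<close>,
  \<open>d\<close>.\<close>

lemma meet_join:
  "meet (join a b) (join c d) = bracket a c d *\<^sub>R b - bracket b c d *\<^sub>R a"
  "meet (join a b) (join c d) = bracket a b d *\<^sub>R c - bracket a b c *\<^sub>R d"
  by (simp_all add: meet_def join_def cross3_def vec_eq_iff forall_3 bracket_expand algebra_simps)

text \<open>The Binet-Cauchy identity for cross products, where a line paired with a point is a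
  bracket.\<close>

lemma bracket_join_meet:
  "bracket (meet (join a b) (join c d)) u v =
     bracket a b u * bracket c d v - bracket a b v * bracket c d u"
  by (simp add: meet_join bracket_expand algebra_simps)

section \<open>Sign conditions for spirals and their invariance under \<open>Tk\<close> and
  \<open>Tk_inv\<close>\<close>

text \<open>Type alpha is \<open>s = 1\<close>, type beta is \<open>s = -1\<close>: the two types differ exactly in the sign of
  the last two brackets, i.e. in the side of \<open>V i V (i+k)\<close> and of \<open>V (i+1) V (i+k)\<close> on which
  \<open>V (i+k+1)\<close> lies.\<close>

definition oriented_spiral :: "real \<Rightarrow> nat \<Rightarrow> int \<Rightarrow> (int \<Rightarrow> real^3) \<Rightarrow> bool" where
  "oriented_spiral s k N V \<longleftrightarrow> (\<forall>i\<ge>N. V i $ 3 > 0 \<and>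
     bracket (V i) (V (i+1)) (V (i+2)) > 0 \<and>
     bracket (V i) (V (i+1)) (V (i + int k)) > 0 \<and>
     bracket (V i) (V (i+1)) (V (i + int k + 1)) > 0 \<and>
     s * bracket (V (i+1)) (V (i + int k)) (V (i + int k + 1)) < 0 \<and>
     s * bracket (V i) (V (i + int k)) (V (i + int k + 1)) > 0)"

text \<open>This is the only sign that is not visible in a single quadruple of points. The line through
  \<open>V (i+1)\<close> and \<open>V (i+k+1)\<close> passes between the two edge lines at \<open>V (i+k+1)\<close>, for which the
  position of \<open>V (i+2k+1)\<close> is known; a Pluecker relation turns this into the sign.\<close>

lemma bracket_diagonal_sign:
  assumes V: "oriented_spiral s k N V" and i: "N \<le> i"
  shows "s * bracket (V (i+1)) (V (i + int k + 1)) (V (i + 2 * int k + 1)) > 0"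
proof -
  let ?a = "V (i+1)" and ?x = "V (i + int k)" and ?p = "V (i + int k + 1)"
    and ?c = "V (i + int k + 2)" and ?y = "V (i + 2 * int k + 1)"
  have idx: "i + 1 + int k = i + int k + 1" "i + 1 + int k + 1 = i + int k + 2"
    "i + int k + int k + 1 = i + 2 * int k + 1" "i + int k + 1 + 1 = i + int k + 2"
    "i + int k + 1 + int k = i + 2 * int k + 1"
    by simp_all
  have le: "N \<le> i + 1" "N \<le> i + int k" "N \<le> i + int k + 1"
    using i by simp_all
  have 1: "s * bracket ?a ?x ?p < 0"
    using V i unfolding oriented_spiral_def by blast
  have 2: "s * bracket ?a ?p ?c > 0"
    using V le(1) unfolding oriented_spiral_def by (metis idx(1,2))
  have 3: "bracket ?x ?p ?c > 0" "bracket ?x ?p ?y > 0"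
    using V le(2) unfolding oriented_spiral_def by (metis idx(3))+
  have 4: "bracket ?p ?c ?y > 0"
    using V le(3) unfolding oriented_spiral_def by (metis idx(4,5))
  \<comment> \<open>Three-term Pluecker relation for \<open>?a\<close>, \<open>?x\<close>,
    \<open>?c\<close>, \<open>?y\<close> seen from \<open>?p\<close>. The minus sign meets a
    negative product, so both terms on the right add up.\<close>
  have "bracket ?x ?p ?c * (s * bracket ?a ?p ?y)
      = (s * bracket ?a ?p ?c) * bracket ?x ?p ?y - (s * bracket ?a ?x ?p) * bracket ?p ?c ?y"
    by (simp add: bracket_expand algebra_simps)
  moreover have "(s * bracket ?a ?p ?c) * bracket ?x ?p ?y > 0"
    using 2 3 by simp
  moreover have "(s * bracket ?a ?x ?p) * bracket ?p ?c ?y < 0"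
    using 1 4 by (simp add: mult_neg_pos)
  ultimately have "bracket ?x ?p ?c * (s * bracket ?a ?p ?y) > 0"
    by linarith
  then show ?thesis
    using 3(1) by (simp add: zero_less_mult_iff)
qed


text \<open>Each required bracket contains two consecutive points of \<open>Tk k V\<close>. They
  span a known diagonal, so only the third point has to be expanded. The bound \<open>N\<close>
  stays because \<open>Tk\<close> at \<open>i\<close> reads \<open>V\<close> only at indices from
  \<open>i\<close> on.\<close>

lemma oriented_spiral_Tk:
  assumes s: "s = 1 \<or> s = -1" and V: "oriented_spiral s k N V"
  shows "oriented_spiral s k N (Tk k V)"
proof -
  define q where "q = int k"
  define X where "X = Tk k V"
  \<comment> \<open>Signs are absorbed into \<open>g\<close> and \<open>h\<close>, so that for both
    types all four coefficients are positive from \<open>N\<close> on.\<close>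
  define K\<^sub>2 K\<^sub>3 g h where "K\<^sub>2 j = bracket (V j) (V (j+1)) (V (j+q))"
    and "K\<^sub>3 j = bracket (V j) (V (j+1)) (V (j+q+1))"
    and "g j = - s * bracket (V (j+1)) (V (j+q)) (V (j+q+1))"
    and "h j = s * bracket (V j) (V (j+q)) (V (j+q+1))" for j
  note defs = K\<^sub>2_def K\<^sub>3_def g_def h_def
  have ss: "s * s = 1" "s * (s * x) = x" for x
    using s by auto
  have pos: "V j $ 3 > 0" "K\<^sub>2 j > 0" "K\<^sub>3 j > 0" "g j > 0" "h j > 0" if "N \<le> j" for j
    using V that unfolding oriented_spiral_def defs q_def by auto
  have X\<^sub>1: "X j = (s * h j) *\<^sub>R V (j+1) + K\<^sub>2 j *\<^sub>R V (j+q+1)" for j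
    unfolding X_def Tk_def meet_join(2) defs q_def
    using bracket_swap(2)[of "V j" "V (j + int k)" "V (j+1)"] by (simp add: ss)
  have X\<^sub>0: "X j = K\<^sub>3 j *\<^sub>R V (j+q) - (s * g j) *\<^sub>R V j" for j
    unfolding X_def Tk_def meet_join(1) defs q_def
    using bracket_swap(1)[of "V (j + int k)" "V (j+1)" "V (j + int k + 1)"] by (simp add: ss)
  have X0': "X (j+1) = K\<^sub>3 (j+1) *\<^sub>R V (j+q+1) - (s * g (j+1)) *\<^sub>R V (j+1)" for j
    using X\<^sub>0[of "j+1"] by (simp add: algebra_simps)
  \<comment> \<open>\<open>X j\<close> and \<open>X (j+1)\<close> are two combinations of
    \<open>V (j+1)\<close> and \<open>V (j+q+1)\<close>; the constant is the determinant of their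
    coefficients with \<open>s\<close> pulled out.\<close>
  have edge: "\<exists>c>0. \<forall>Y. bracket (X j) (X (j+1)) Y = s * c * bracket (V (j+1)) (V (j+q+1)) Y"
    if "N \<le> j" for j
  proof (intro exI conjI allI)
    show "h j * K\<^sub>3 (j+1) + g (j+1) * K\<^sub>2 j > 0"
      using that by (intro add_pos_pos mult_pos_pos pos) auto
    show "bracket (X j) (X (j+1)) Y
        = s * (h j * K\<^sub>3 (j+1) + g (j+1) * K\<^sub>2 j) * bracket (V (j+1)) (V (j+q+1)) Y" for Y
      unfolding X\<^sub>1[of j] X0' using bracket_swap(1)[of "V (j+q+1)" "V (j+1)" Y]
      by (simp add: algebra_simps)
  qed
  have main: "X i $ 3 > 0 \<and>
     bracket (X i) (X (i+1)) (X (i+2)) > 0 \<and>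
     bracket (X i) (X (i+1)) (X (i + q)) > 0 \<and>
     bracket (X i) (X (i+1)) (X (i + q + 1)) > 0 \<and>
     s * bracket (X (i+1)) (X (i + q)) (X (i + q + 1)) < 0 \<and>
     s * bracket (X i) (X (i + q)) (X (i + q + 1)) > 0" if i: "N \<le> i" for i
  proof -
    let ?p = "V (i+1)" and ?r = "V (i+q+1)" and ?y = "V (i+2*q+1)"
    have le: "N \<le> i+1" "N \<le> i+2" "N \<le> i+q" "N \<le> i+q+1"
      using i by (auto simp: q_def)
    have D: "s * bracket ?p ?r ?y > 0"
      unfolding q_def by (rule bracket_diagonal_sign[OF V i])
    obtain c where c: "c > 0" "\<And>Y. bracket (X i) (X (i+1)) Y = s * c * bracket ?p ?r Y"
      using edge[OF i] by blast
    obtain d where d: "d > 0" "\<And>Y. bracket (X (i+q)) (X (i+q+1)) Y = s * d * bracket ?r ?y Y"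
      using edge[OF le(3)] by (auto simp: algebra_simps)
    have X2: "X (i+2) = K\<^sub>3 (i+2) *\<^sub>R V (i+q+2) - (s * g (i+2)) *\<^sub>R V (i+2)"
      using X\<^sub>0[of "i+2"] by (simp add: algebra_simps)
    have Xq: "X (i+q) = (s * h (i+q)) *\<^sub>R ?r + K\<^sub>2 (i+q) *\<^sub>R ?y"
      using X\<^sub>1[of "i+q"] by (simp add: algebra_simps)
    have Xq1: "X (i+q+1) = K\<^sub>3 (i+q+1) *\<^sub>R ?y - (s * g (i+q+1)) *\<^sub>R ?r"
      using X0'[of "i+q"] by (simp add: algebra_simps)
    have h1: "s * bracket ?p ?r (V (i+q+2)) = h (i+1)"
      unfolding h_def by (simp add: algebra_simps)
    have k1: "bracket ?p ?r (V (i+2)) = - K\<^sub>2 (i+1)"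
      unfolding K\<^sub>2_def using bracket_swap(2)[of ?p ?r "V (i+2)"] by (simp add: algebra_simps)
    \<comment> \<open>Expanding \<open>X (i+2)\<close> over \<open>V (i+2)\<close> and
      \<open>V (i+q+2)\<close> leaves only brackets known at index \<open>i+1\<close>.\<close>
    have "bracket (X i) (X (i+1)) (X (i+2))
        = c * (K\<^sub>3 (i+2) * (s * bracket ?p ?r (V (i+q+2))) - g (i+2) * bracket ?p ?r (V (i+2)))"
      unfolding c(2) X2 by (simp add: algebra_simps ss)
    then have "bracket (X i) (X (i+1)) (X (i+2)) = c * (K\<^sub>3 (i+2) * h (i+1) + g (i+2) * K\<^sub>2 (i+1))"
      unfolding h1 k1 by simp
    moreover have "K\<^sub>3 (i+2) * h (i+1) + g (i+2) * K\<^sub>2 (i+1) > 0"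
      using le by (intro add_pos_pos mult_pos_pos pos)
    ultimately have C: "bracket (X i) (X (i+1)) (X (i+2)) > 0"
      using c(1) by simp
    \<comment> \<open>The component of \<open>X (i+q)\<close> along \<open>?r\<close> lies on the
      spanned diagonal and drops out, which leaves the sign in \<open>D\<close>. The remaining
      brackets reduce to \<open>D\<close> in the same way.\<close>
    have "bracket (X i) (X (i+1)) (X (i+q)) = c * K\<^sub>2 (i+q) * (s * bracket ?p ?r ?y)"
      unfolding c(2) Xq by simp
    then have 2: "bracket (X i) (X (i+1)) (X (i+q)) > 0"
      using c(1) pos(2)[OF le(3)] D by simp
    have "bracket (X i) (X (i+1)) (X (i+q+1)) = c * K\<^sub>3 (i+q+1) * (s * bracket ?p ?r ?y)"
      unfolding c(2) Xq1 by simp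
    then have 3: "bracket (X i) (X (i+1)) (X (i+q+1)) > 0"
      using c(1) pos(3)[OF le(4)] D by simp
    have "s * bracket (X (i+1)) (X (i+q)) (X (i+q+1)) = s * (s * d * bracket ?r ?y (X (i+1)))"
      using bracket_rotate[of "X (i+1)" "X (i+q)" "X (i+q+1)"] d(2) by simp
    also have "\<dots> = - (d * g (i+1) * (s * bracket ?p ?r ?y))"
      unfolding X0'[of i] using bracket_rotate[of ?p ?r ?y] by (simp add: ss)
    finally have 4: "s * bracket (X (i+1)) (X (i+q)) (X (i+q+1)) < 0"
      using d(1) pos(4)[OF le(1)] D by simp
    have "s * bracket (X i) (X (i+q)) (X (i+q+1)) = s * (s * d * bracket ?r ?y (X i))"
      using bracket_rotate[of "X i" "X (i+q)" "X (i+q+1)"] d(2) by simp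
    also have "\<dots> = d * h i * (s * bracket ?p ?r ?y)"
      unfolding X\<^sub>1[of i] using bracket_rotate[of ?p ?r ?y] by (simp add: ss)
    also have "\<dots> > 0"
      using d(1) pos(5)[OF i] D by (simp only: mult_pos_pos)
    finally have 5: "s * bracket (X i) (X (i+q)) (X (i+q+1)) > 0" .
    \<comment> \<open>Of the two expansions of \<open>X i\<close>, the type decides which one has
      positive coefficients.\<close>
    have "X i $ 3 > 0"
      using s
    proof
      assume "s = 1"
      then show ?thesis
        using X\<^sub>1[of i] pos[OF i] pos(1)[OF le(4)] pos(1)[OF le(1)] by (simp add: add_pos_pos)
    next
      assume "s = -1"
      then show ?thesis
        using X\<^sub>0[of i] pos[OF i] pos(1)[OF le(3)] by (simp add: add_pos_pos)
    qed
    with C 2 3 4 5 show ?thesis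
      by blast
  qed
  then show ?thesis
    unfolding oriented_spiral_def X_def q_def by blast
qed

text \<open>The bound moves by \<open>k + 1\<close> because \<open>Tk_inv\<close> at
  \<open>i\<close> reads \<open>V\<close> from index \<open>i - k - 1\<close> on. The factor
  \<open>s\<close> makes the third coordinates positive.\<close>

lemma oriented_spiral_Tk_inv:
  assumes s: "s = 1 \<or> s = -1" and V: "oriented_spiral s k N V"
  shows "oriented_spiral s k (N + int k + 1) (\<lambda>i. s *\<^sub>R Tk_inv k V i)"
proof -
  define q where "q = int k"
  \<comment> \<open>Reindexed so that \<open>R j\<close> is the intersection of the edge lines of
    \<open>V\<close> starting at \<open>j\<close> and at \<open>j + k\<close>.\<close>
  define R where "R j = s *\<^sub>R Tk_inv k V (j + q + 1)" for j
  define K\<^sub>2 K\<^sub>3 g h C where "K\<^sub>2 j = bracket (V j) (V (j+1)) (V (j+q))"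
    and "K\<^sub>3 j = bracket (V j) (V (j+1)) (V (j+q+1))"
    and "g j = - s * bracket (V (j+1)) (V (j+q)) (V (j+q+1))"
    and "h j = s * bracket (V j) (V (j+q)) (V (j+q+1))"
    and "C j = bracket (V j) (V (j+1)) (V (j+2))" for j
  note defs = K\<^sub>2_def K\<^sub>3_def g_def h_def C_def
  have ss: "s * s = 1" "s * (s * x) = x" for x
    using s by auto
  have pos: "V j $ 3 > 0" "K\<^sub>2 j > 0" "K\<^sub>3 j > 0" "g j > 0" "h j > 0" "C j > 0" if "N \<le> j" for j
    using V that unfolding oriented_spiral_def defs q_def by auto
  have Rmeet: "R j = s *\<^sub>R meet (join (V j) (V (j+1))) (join (V (j+q)) (V (j+q+1)))" for j
    unfolding R_def Tk_inv_def q_def by (simp add: algebra_simps)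
  have R\<^sub>0: "R j = h j *\<^sub>R V (j+1) + g j *\<^sub>R V j" for j
    unfolding Rmeet meet_join(1) defs by (simp add: algebra_simps)
  have R\<^sub>1: "R j = (s * K\<^sub>3 j) *\<^sub>R V (j+q) - (s * K\<^sub>2 j) *\<^sub>R V (j+q+1)" for j
    unfolding Rmeet meet_join(2) defs by (simp add: algebra_simps)
  \<comment> \<open>Both \<open>R j\<close> and \<open>R (j+q)\<close> lie on the edge line of
    \<open>V\<close> at \<open>j+q\<close>; the constant is again a determinant of
    coefficients.\<close>
  have edge: "\<exists>d>0. \<forall>Y. bracket (R j) (R (j+q)) Y = s * d * bracket (V (j+q)) (V (j+q+1)) Y"
    if "N \<le> j" for j
  proof (intro exI conjI allI)
    have "N \<le> j + q"
      using that by (simp add: q_def)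
    then show "K\<^sub>3 j * h (j+q) + K\<^sub>2 j * g (j+q) > 0"
      using that by (intro add_pos_pos mult_pos_pos pos)
    show "bracket (R j) (R (j+q)) Y
        = s * (K\<^sub>3 j * h (j+q) + K\<^sub>2 j * g (j+q)) * bracket (V (j+q)) (V (j+q+1)) Y" for Y
      unfolding R\<^sub>1[of j] R\<^sub>0[of "j+q"] using bracket_swap(1)[of "V (j+q+1)" "V (j+q)" Y]
      by (simp add: algebra_simps)
  qed
  have main: "R i $ 3 > 0 \<and>
     bracket (R i) (R (i+1)) (R (i+2)) > 0 \<and>
     bracket (R i) (R (i+1)) (R (i + q)) > 0 \<and>
     bracket (R i) (R (i+1)) (R (i + q + 1)) > 0 \<and>
     s * bracket (R (i+1)) (R (i + q)) (R (i + q + 1)) < 0 \<and>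
     s * bracket (R i) (R (i + q)) (R (i + q + 1)) > 0" if i: "N \<le> i" for i
  proof -
    let ?a = "V (i+1)" and ?b = "V (i+2)"
      and ?x = "V (i+q)" and ?y = "V (i+q+1)" and ?z = "V (i+q+2)"
    have le: "N \<le> i+1" "N \<le> i+2" "N \<le> i+q" "N \<le> i+q+1"
      using i by (auto simp: q_def)
    have R1: "R (i+1) = (s * K\<^sub>3 (i+1)) *\<^sub>R ?y - (s * K\<^sub>2 (i+1)) *\<^sub>R ?z"
      using R\<^sub>1[of "i+1"] by (simp add: algebra_simps)
    have Rq1: "R (i+q+1) = h (i+q+1) *\<^sub>R ?z + g (i+q+1) *\<^sub>R ?y"
      using R\<^sub>0[of "i+q+1"] by (simp add: algebra_simps)
    obtain d where d: "d > 0" "\<And>Y. bracket (R i) (R (i+q)) Y = s * d * bracket ?x ?y Y"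
      using edge[OF i] by blast
    obtain e where e: "e > 0" "\<And>Y. bracket (R (i+1)) (R (i+q+1)) Y = s * e * bracket ?y ?z Y"
      using edge[OF le(1)] by (auto simp: algebra_simps)
    have Cq: "bracket ?x ?y ?z = C (i+q)" "bracket ?y ?z ?x = C (i+q)"
      unfolding C_def using bracket_rotate[of ?x ?y ?z] by (auto simp: algebra_simps)
    have Ca: "bracket ?a ?b (R i) = g i * C i" "bracket ?a ?b (R (i+2)) = h (i+2) * C (i+1)"
      unfolding R\<^sub>0[of i] R\<^sub>0[of "i+2"] C_def using bracket_rotate[of "V i" ?a ?b]
      by (auto simp: algebra_simps)
    have R2: "R (i+2) = (s * K\<^sub>3 (i+2)) *\<^sub>R ?z - (s * K\<^sub>2 (i+2)) *\<^sub>R V (i+q+3)"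
      using R\<^sub>1[of "i+2"] by (simp add: algebra_simps)
    have Cy: "bracket ?y ?z (R i) = s * K\<^sub>3 i * C (i+q)"
      "bracket ?y ?z (R (i+2)) = - s * K\<^sub>2 (i+2) * C (i+q+1)"
      unfolding R\<^sub>1[of i] R2 using Cq(2) unfolding C_def by (auto simp: algebra_simps)
    \<comment> \<open>\<open>R (i+1)\<close> is a corner of the lines \<open>?a ?b\<close> and \<open>?y ?z\<close>, whose sides separate
      the directions to \<open>R i\<close> and \<open>R (i+2)\<close>.\<close>
    have "R (i+1) = s *\<^sub>R meet (join ?a ?b) (join ?y ?z)"
      unfolding Rmeet by (simp add: algebra_simps)
    with bracket_swap(1)[of "R i" "R (i+1)" "R (i+2)"]
    have "bracket (R i) (R (i+1)) (R (i+2))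
        = - bracket (s *\<^sub>R meet (join ?a ?b) (join ?y ?z)) (R i) (R (i+2))"
      by (simp only:)
    also have "\<dots> = - (s * (bracket ?a ?b (R i) * bracket ?y ?z (R (i+2))
            - bracket ?a ?b (R (i+2)) * bracket ?y ?z (R i)))"
      by (simp only: bracket_linear bracket_join_meet)
    also have "\<dots> = g i * C i * (K\<^sub>2 (i+2) * C (i+q+1)) + h (i+2) * C (i+1) * (K\<^sub>3 i * C (i+q))"
      unfolding Ca Cy by (simp add: algebra_simps ss)
    also have "\<dots> > 0"
      using i le by (intro add_pos_pos mult_pos_pos pos)
    finally have 1: "bracket (R i) (R (i+1)) (R (i+2)) > 0" .
    \<comment> \<open>The pair with index difference \<open>k\<close> is brought to the front so
      that \<open>edge\<close> applies; the third point then contributes only its component off that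
      edge line.\<close>
    have "bracket (R i) (R (i+1)) (R (i+q)) = - bracket (R i) (R (i+q)) (R (i+1))"
      by (rule bracket_swap)
    also have "\<dots> = d * (K\<^sub>2 (i+1) * C (i+q))"
      unfolding d(2) R1 by (simp add: Cq ss)
    also have "\<dots> > 0"
      using d(1) le by (intro mult_pos_pos pos)
    finally have 2: "bracket (R i) (R (i+1)) (R (i+q)) > 0" .
    have "bracket (R i) (R (i+1)) (R (i+q+1)) = bracket (R (i+1)) (R (i+q+1)) (R i)"
      by (rule bracket_rotate)
    also have "\<dots> = e * (K\<^sub>3 i * C (i+q))"
      unfolding e(2) Cy by (simp add: ss)
    also have "\<dots> > 0"
      using e(1) i le by (intro mult_pos_pos pos)
    finally have 3: "bracket (R i) (R (i+1)) (R (i+q+1)) > 0" .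
    have "s * bracket (R (i+1)) (R (i+q)) (R (i+q+1))
        = - (s * bracket (R (i+1)) (R (i+q+1)) (R (i+q)))"
      using bracket_swap(2)[of "R (i+1)" "R (i+q)" "R (i+q+1)"] by (simp only: mult_minus_right)
    also have "\<dots> = - (e * (g (i+q) * C (i+q)))"
      unfolding e(2) R\<^sub>0[of "i+q"] by (simp add: Cq ss)
    finally have 4: "s * bracket (R (i+1)) (R (i+q)) (R (i+q+1)) < 0"
      using e(1) pos[OF le(3)] by simp
    have "s * bracket (R i) (R (i+q)) (R (i+q+1)) = d * (h (i+q+1) * C (i+q))"
      unfolding d(2) Rq1 by (simp add: Cq ss)
    also have "\<dots> > 0"
      using d(1) le by (intro mult_pos_pos pos)
    finally have 5: "s * bracket (R i) (R (i+q)) (R (i+q+1)) > 0" .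
    have "R i $ 3 > 0"
      using R\<^sub>0[of i] pos[OF i] pos(1)[OF le(1)] by (simp add: add_pos_pos)
    with 1 2 3 4 5 show ?thesis
      by blast
  qed
  have shift: "s *\<^sub>R Tk_inv k V i = R (i - q - 1)" for i
    unfolding R_def by simp
  show ?thesis
    unfolding oriented_spiral_def shift
  proof (intro allI impI)
    fix i assume "N + int k + 1 \<le> i"
    then have "N \<le> i - q - 1"
      by (simp add: q_def)
    from main[OF this] show "R (i - q - 1) $ 3 > 0 \<and>
     bracket (R (i - q - 1)) (R (i + 1 - q - 1)) (R (i + 2 - q - 1)) > 0 \<and>
     bracket (R (i - q - 1)) (R (i + 1 - q - 1)) (R (i + int k - q - 1)) > 0 \<and>
     bracket (R (i - q - 1)) (R (i + 1 - q - 1)) (R (i + int k + 1 - q - 1)) > 0 \<and>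
     s * bracket (R (i + 1 - q - 1)) (R (i + int k - q - 1)) (R (i + int k + 1 - q - 1)) < 0 \<and>
     s * bracket (R (i - q - 1)) (R (i + int k - q - 1)) (R (i + int k + 1 - q - 1)) > 0"
      by (simp add: q_def algebra_simps)
  qed
qed

section \<open>Triangles in the affine patch and the translation of representatives into bracket
  signs\<close>

lemma bracket_cramer:
  "bracket a b c *\<^sub>R x = bracket b c x *\<^sub>R a + bracket c a x *\<^sub>R b + bracket a b x *\<^sub>R c"
  by (simp add: vec_eq_iff forall_3 bracket_expand algebra_simps)

lemma lift_component [simp]: "lift p $ 1 = p $ 1" "lift p $ 2 = p $ 2" "lift p $ 3 = 1"
  by (simp_all add: lift_def)

lemma lift_combination:
  assumes "x + y + z = 1"
  shows "lift (x *\<^sub>R a + y *\<^sub>R b + z *\<^sub>R c) = x *\<^sub>R lift a + y *\<^sub>R lift b + z *\<^sub>R lift c"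
  using assms by (simp add: vec_eq_iff forall_3)

lemma lift_eq_iff: "lift a = lift b \<longleftrightarrow> a = b"
  by (auto simp: vec_eq_iff forall_3 forall_2)

text \<open>The three brackets are the barycentric coordinates of \<open>p\<close> multiplied by the
  positive bracket of the vertices, and interior points are those with positive barycentric
  coordinates.\<close>

lemma interior_triangle_iff:
  assumes D: "bracket (lift a) (lift b) (lift c) > 0"
  shows "p \<in> interior (convex hull {a, b, c}) \<longleftrightarrow>
    bracket (lift a) (lift b) (lift p) > 0 \<and> bracket (lift b) (lift c) (lift p) > 0 \<and>
    bracket (lift c) (lift a) (lift p) > 0"
    (is "_ \<longleftrightarrow> ?ab > 0 \<and> ?bc > 0 \<and> ?ca > 0")
proof -
  let ?D = "bracket (lift a) (lift b) (lift c)"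
  have rot: "bracket (lift b) (lift c) (lift a) = ?D" "bracket (lift c) (lift a) (lift b) = ?D"
    by (metis bracket_rotate)+
  have "\<not> collinear {a, b, c}"
  proof
    assume "collinear {a, b, c}"
    then consider "a = c" | u where "b = u *\<^sub>R a + (1 - u) *\<^sub>R c"
      by (auto simp: collinear_3_expand)
    then have "?D = 0"
    proof cases
      case 2
      then have "lift b = u *\<^sub>R lift a + (1 - u) *\<^sub>R lift c"
        using lift_combination[of u 0 "1 - u" a a c] by simp
      then show ?thesis by simp
    qed simp
    then show False using D by simp
  qed
  then have int: "p \<in> interior (convex hull {a, b, c}) \<longleftrightarrow>
      (\<exists>x y z. 0 < x \<and> 0 < y \<and> 0 < z \<and> x + y + z = 1 \<and> x *\<^sub>R a + y *\<^sub>R b + z *\<^sub>R c = p)"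
    by (simp add: interior_convex_hull_3_minimal)
  show ?thesis
    unfolding int
  proof (intro iffI)
    assume "\<exists>x y z. 0 < x \<and> 0 < y \<and> 0 < z \<and> x + y + z = 1 \<and> x *\<^sub>R a + y *\<^sub>R b + z *\<^sub>R c = p"
    then obtain x y z where *: "0 < x" "0 < y" "0 < z" "x + y + z = 1"
      and p: "x *\<^sub>R a + y *\<^sub>R b + z *\<^sub>R c = p" by blast
    have "lift p = x *\<^sub>R lift a + y *\<^sub>R lift b + z *\<^sub>R lift c"
      using lift_combination[OF *(4)] p by metis
    then show "?ab > 0 \<and> ?bc > 0 \<and> ?ca > 0"
      using * D by (simp add: rot)
  next
    assume *: "?ab > 0 \<and> ?bc > 0 \<and> ?ca > 0"
    have cramer: "?D *\<^sub>R lift p = ?bc *\<^sub>R lift a + ?ca *\<^sub>R lift b + ?ab *\<^sub>R lift c"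
      by (rule bracket_cramer)
    \<comment> \<open>All lifts have third coordinate 1, so this coordinate of Cramer's rule says
      that the weights sum to 1 after division by \<open>?D\<close>.\<close>
    have sum: "?bc + ?ca + ?ab = ?D"
      using arg_cong[OF cramer, of "\<lambda>v. v $ 3"] by simp
    then have 1: "?bc / ?D + ?ca / ?D + ?ab / ?D = 1"
      using D by (simp flip: add_divide_distrib)
    have "lift p = (1 / ?D) *\<^sub>R (?D *\<^sub>R lift p)"
      using D by simp
    also have "\<dots> = (?bc / ?D) *\<^sub>R lift a + (?ca / ?D) *\<^sub>R lift b + (?ab / ?D) *\<^sub>R lift c"
      unfolding cramer by (simp add: scaleR_add_right)
    also have "\<dots> = lift ((?bc / ?D) *\<^sub>R a + (?ca / ?D) *\<^sub>R b + (?ab / ?D) *\<^sub>R c)"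
      by (rule lift_combination[OF 1, symmetric])
    finally have "(?bc / ?D) *\<^sub>R a + (?ca / ?D) *\<^sub>R b + (?ab / ?D) *\<^sub>R c = p"
      by (simp add: lift_eq_iff)
    moreover have "?bc / ?D > 0" "?ca / ?D > 0" "?ab / ?D > 0"
      using * D by simp_all
    ultimately show "\<exists>x y z. 0 < x \<and> 0 < y \<and> 0 < z \<and> x + y + z = 1 \<and> x *\<^sub>R a + y *\<^sub>R b + z *\<^sub>R c = p"
      using 1 by blast
  qed
qed

lemma lift_aff: "v $ 3 \<noteq> 0 \<Longrightarrow> lift (aff v) = (1 / v $ 3) *\<^sub>R v"
  by (simp add: vec_eq_iff forall_3 aff_def)

lemma bracket_lift_aff_pos_iff:
  assumes "u $ 3 > 0" "v $ 3 > 0" "w $ 3 > 0"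
  shows "bracket (lift (aff u)) (lift (aff v)) (lift (aff w)) > 0 \<longleftrightarrow> bracket u v w > 0"
proof -
  have "bracket (lift (aff u)) (lift (aff v)) (lift (aff w))
      = bracket u v w / (u $ 3 * v $ 3 * w $ 3)"
    using assms by (simp add: lift_aff)
  moreover have "u $ 3 * v $ 3 * w $ 3 > 0"
    using assms by simp
  ultimately show ?thesis
    by (simp add: zero_less_divide_iff)
qed

lemma positive3_iff:
  assumes "u $ 3 > 0" "v $ 3 > 0" "w $ 3 > 0"
  shows "positive3 u v w \<longleftrightarrow> bracket u v w > 0"
proof -
  have "orient u v w = bracket (lift (aff u)) (lift (aff v)) (lift (aff w))"
    by (simp add: orient_def det_transpose bracket_def dot_cross_det)
  then show ?thesis
    using bracket_lift_aff_pos_iff[OF assms] by (simp add: positive3_def)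
qed

lemma in_triangle_iff:
  assumes "a $ 3 > 0" "b $ 3 > 0" "c $ 3 > 0" "x $ 3 > 0" "bracket a b c > 0"
  shows "in_triangle x a b c \<longleftrightarrow> bracket a b x > 0 \<and> bracket b c x > 0 \<and> bracket c a x > 0"
  unfolding in_triangle_def using assms
  by (subst interior_triangle_iff) (simp_all add: bracket_lift_aff_pos_iff)

text \<open>Triangle membership supplies three of the five brackets and the two positivity
  conditions the others; swaps and rotations give the order used in
  \<open>oriented_spiral\<close>.\<close>

lemma N_rep_alpha_iff:
  assumes pos: "\<And>i. N \<le> i \<Longrightarrow> V i $ 3 > 0"
  shows "N_rep_alpha k N V \<longleftrightarrow> oriented_spiral 1 k N V"
proof -
  have "in_affine (V i) \<and> positive3 (V i) (V (i+1)) (V (i+2)) \<and>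
        positive3 (V i) (V (i+1)) (V (i + int k + 1)) \<and>
        in_triangle (V (i + int k)) (V i) (V (i+1)) (V (i + int k + 1)) \<longleftrightarrow>
      V i $ 3 > 0 \<and> bracket (V i) (V (i+1)) (V (i+2)) > 0 \<and>
        bracket (V i) (V (i+1)) (V (i + int k)) > 0 \<and>
        bracket (V i) (V (i+1)) (V (i + int k + 1)) > 0 \<and>
        1 * bracket (V (i+1)) (V (i + int k)) (V (i + int k + 1)) < 0 \<and>
        1 * bracket (V i) (V (i + int k)) (V (i + int k + 1)) > 0" if "N \<le> i" for i
  proof -
    have z: "V i $ 3 > 0" "V (i+1) $ 3 > 0" "V (i+2) $ 3 > 0" "V (i + int k) $ 3 > 0"
      "V (i + int k + 1) $ 3 > 0"
      using that by (auto intro!: pos)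
    show ?thesis
      using z in_triangle_iff[of "V i" "V (i+1)" "V (i + int k + 1)" "V (i + int k)"]
        bracket_swap(2)[of "V (i+1)" "V (i + int k + 1)" "V (i + int k)"]
        bracket_rotate[of "V (i + int k + 1)" "V i" "V (i + int k)"]
      by (auto simp: positive3_iff in_affine_def)
  qed
  then show ?thesis
    unfolding N_rep_alpha_def oriented_spiral_def by blast
qed

lemma N_rep_beta_iff:
  assumes pos: "\<And>i. N \<le> i \<Longrightarrow> V i $ 3 > 0"
  shows "N_rep_beta k N V \<longleftrightarrow> oriented_spiral (-1) k N V"
proof -
  have "in_affine (V i) \<and> positive3 (V i) (V (i+1)) (V (i+2)) \<and>
        positive3 (V i) (V (i+1)) (V (i + int k)) \<and>
        in_triangle (V (i + int k + 1)) (V i) (V (i+1)) (V (i + int k)) \<longleftrightarrow>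
      V i $ 3 > 0 \<and> bracket (V i) (V (i+1)) (V (i+2)) > 0 \<and>
        bracket (V i) (V (i+1)) (V (i + int k)) > 0 \<and>
        bracket (V i) (V (i+1)) (V (i + int k + 1)) > 0 \<and>
        - 1 * bracket (V (i+1)) (V (i + int k)) (V (i + int k + 1)) < 0 \<and>
        - 1 * bracket (V i) (V (i + int k)) (V (i + int k + 1)) > 0" if "N \<le> i" for i
  proof -
    have z: "V i $ 3 > 0" "V (i+1) $ 3 > 0" "V (i+2) $ 3 > 0" "V (i + int k) $ 3 > 0"
      "V (i + int k + 1) $ 3 > 0"
      using that by (auto intro!: pos)
    show ?thesis
      using z in_triangle_iff[of "V i" "V (i+1)" "V (i + int k)" "V (i + int k + 1)"]
        bracket_swap(1)[of "V (i + int k)" "V i" "V (i + int k + 1)"]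
      by (auto simp: positive3_iff in_affine_def)
  qed
  then show ?thesis
    unfolding N_rep_beta_def oriented_spiral_def by blast
qed

text \<open>Off the affine patch, where \<open>aff\<close> divides by zero, the vector is kept so that the projective
  point never changes.\<close>

definition affine_lift :: "(int \<Rightarrow> real^3) \<Rightarrow> int \<Rightarrow> real^3" where
  "affine_lift Q i = (if Q i $ 3 = 0 then Q i else lift (aff (Q i)))"

lemma affine_lift_scale: "\<exists>c. c \<noteq> 0 \<and> affine_lift Q i = c *\<^sub>R Q i"
  by (cases "Q i $ 3 = 0")
     (auto simp: affine_lift_def lift_aff intro: exI[of _ 1] exI[of _ "1 / Q i $ 3"])

lemma aff_affine_lift: "aff (affine_lift Q i) = aff (Q i)"
  by (simp add: affine_lift_def aff_def)

text \<open>Both notions see a vector only through \<open>aff\<close> and the vanishing of its third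
  coordinate, and normalization keeps both.\<close>

lemma N_rep_affine_lift:
  "N_rep_alpha k N (affine_lift Q) \<longleftrightarrow> N_rep_alpha k N Q"
  "N_rep_beta k N (affine_lift Q) \<longleftrightarrow> N_rep_beta k N Q"
proof -
  have "in_affine (affine_lift Q i) \<longleftrightarrow> in_affine (Q i)" for i
    by (simp add: in_affine_def affine_lift_def)
  then show "N_rep_alpha k N (affine_lift Q) \<longleftrightarrow> N_rep_alpha k N Q"
    "N_rep_beta k N (affine_lift Q) \<longleftrightarrow> N_rep_beta k N Q"
    by (simp_all add: N_rep_alpha_def N_rep_beta_def positive3_def orient_def in_triangle_def
        aff_affine_lift)
qed

lemma affine_lift_pos: "in_affine (Q i) \<Longrightarrow> affine_lift Q i $ 3 > 0"
  by (simp add: in_affine_def affine_lift_def)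

lemma N_rep_oriented_spiral:
  "N_rep_alpha k N Q \<Longrightarrow> oriented_spiral 1 k N (affine_lift Q)"
  "N_rep_beta k N Q \<Longrightarrow> oriented_spiral (-1) k N (affine_lift Q)"
proof -
  show "oriented_spiral 1 k N (affine_lift Q)" if "N_rep_alpha k N Q"
    using that N_rep_alpha_iff[of N "affine_lift Q" k] affine_lift_pos
    unfolding N_rep_affine_lift unfolding N_rep_alpha_def by blast
  show "oriented_spiral (-1) k N (affine_lift Q)" if "N_rep_beta k N Q"
    using that N_rep_beta_iff[of N "affine_lift Q" k] affine_lift_pos
    unfolding N_rep_affine_lift unfolding N_rep_beta_def by blast
qed

lemma oriented_spiral_N_rep:
  "oriented_spiral 1 k N V \<Longrightarrow> N_rep_alpha k N V"
  "oriented_spiral (-1) k N V \<Longrightarrow> N_rep_beta k N V"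
  by (subst N_rep_alpha_iff N_rep_beta_iff; auto simp: oriented_spiral_def)+

section \<open>Projective equivariance\<close>

text \<open>Lines transform by the cofactor matrix, which is \<open>det A\<close> times the inverse
  transpose \<open>T\<close>.\<close>

lemma invertible_cross_matrix:
  fixes A :: "real^3^3"
  assumes "invertible A"
  obtains B where "invertible B" "\<And>x y. (A *v x) \<times> (A *v y) = B *v (x \<times> y)"
proof -
  have "invertible (transpose A)" and det: "det A \<noteq> 0"
    using assms by (simp_all add: invertible_det_nz)
  then obtain T where T: "transpose A ** T = mat 1" "T ** transpose A = mat 1"
    unfolding invertible_def by blast
  show thesis
  proof (rule that)
    have "invertible T"
      using T unfolding invertible_def by blast
    then show "invertible (det A *\<^sub>R T)"
      using det by (intro scalar_invertible)
    fix x y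
    have "(A *v x) \<times> (A *v y) = T *v (transpose A *v ((A *v x) \<times> (A *v y)))"
      by (simp add: matrix_vector_mul_assoc T del: transpose_matrix_vector)
    also have "\<dots> = (det A *\<^sub>R T) *v (x \<times> y)"
      unfolding cross_matrix_mult by (simp add: matrix_vector_mult_scaleR scaleR_matrix_vector_assoc)
    finally show "(A *v x) \<times> (A *v y) = (det A *\<^sub>R T) *v (x \<times> y)" .
  qed
qed

text \<open>The cofactor matrix is taken once for the joins and once more for the meet; the result
  is \<open>det A\<close> times \<open>A\<close>.\<close>

lemma invertible_meet_join:
  fixes A :: "real^3^3"
  assumes "invertible A"
  obtains B where "invertible B"
    "\<And>a b c d. meet (join (A *v a) (A *v b)) (join (A *v c) (A *v d)) = B *v meet (join a b) (join c d)"
proof -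
  obtain B where B: "invertible B" "\<And>x y. (A *v x) \<times> (A *v y) = B *v (x \<times> y)"
    using invertible_cross_matrix[OF assms] by blast
  obtain C where C: "invertible C" "\<And>x y. (B *v x) \<times> (B *v y) = C *v (x \<times> y)"
    using invertible_cross_matrix[OF B(1)] by blast
  show thesis
    by (rule that[OF C(1)]) (simp add: meet_def join_def B(2) C(2))
qed

lemma meet_join_scale:
  "meet (join (\<alpha> *\<^sub>R a) (\<beta> *\<^sub>R b)) (join (\<gamma> *\<^sub>R c) (\<delta> *\<^sub>R d))
     = (\<alpha> * \<beta> * \<gamma> * \<delta>) *\<^sub>R meet (join a b) (join c d)"
  by (simp add: meet_def join_def cross_mult_left cross_mult_right algebra_simps)

text \<open>Arbitrary index maps let one statement serve both \<open>Tk\<close> and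
  \<open>Tk_inv\<close>.\<close>

lemma proj_equiv_meet_join:
  assumes "proj_equiv P Q"
  shows "proj_equiv (\<lambda>i. meet (join (P (\<alpha> i)) (P (\<beta> i))) (join (P (\<gamma> i)) (P (\<delta> i))))
                    (\<lambda>i. meet (join (Q (\<alpha> i)) (Q (\<beta> i))) (join (Q (\<gamma> i)) (Q (\<delta> i))))"
proof -
  obtain A where "invertible A" "\<forall>i. proj_eq (Q i) (A *v P i)"
    using assms unfolding proj_equiv_def by blast
  then obtain c where c: "\<And>i. c i \<noteq> 0" "\<And>i. Q i = c i *\<^sub>R (A *v P i)"
    unfolding proj_eq_def by metis
  obtain B where B: "invertible B" "\<And>a b c d. meet (join (A *v a) (A *v b)) (join (A *v c) (A *v d))
      = B *v meet (join a b) (join c d)"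
    using invertible_meet_join \<open>invertible A\<close> by metis
  show ?thesis
    unfolding proj_equiv_def proj_eq_def
  proof (intro exI[of _ B] conjI allI)
    fix i
    show "\<exists>d. d \<noteq> 0 \<and> meet (join (Q (\<alpha> i)) (Q (\<beta> i))) (join (Q (\<gamma> i)) (Q (\<delta> i)))
        = d *\<^sub>R (B *v meet (join (P (\<alpha> i)) (P (\<beta> i))) (join (P (\<gamma> i)) (P (\<delta> i))))"
      unfolding c(2) meet_join_scale B(2)
      by (intro exI[of _ "c (\<alpha> i) * c (\<beta> i) * c (\<gamma> i) * c (\<delta> i)"]) (simp add: c(1))
  qed (fact B(1))
qed

lemma proj_equiv_Tk: "proj_equiv P Q \<Longrightarrow> proj_equiv (Tk k P) (Tk k Q)"
  unfolding Tk_def by (rule proj_equiv_meet_join)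

lemma proj_equiv_Tk_inv: "proj_equiv P Q \<Longrightarrow> proj_equiv (Tk_inv k P) (Tk_inv k Q)"
  unfolding Tk_inv_def by (rule proj_equiv_meet_join)

lemma proj_equiv_rescale:
  assumes "proj_equiv P Q" "\<And>i. \<exists>c. c \<noteq> 0 \<and> V i = c *\<^sub>R Q i"
  shows "proj_equiv P V"
proof -
  have "proj_eq (V i) x" if "proj_eq (Q i) x" for i x
    using that assms(2)[of i] unfolding proj_eq_def
    by (metis mult_eq_0_iff scaleR_scaleR)
  then show ?thesis
    using assms(1) unfolding proj_equiv_def by blast
qed

text \<open>The bracket is multiplied by \<open>det A\<close> and three nonzero scalars.\<close>

lemma proj_equiv_bracket:
  assumes "proj_equiv P Q"
  shows "bracket (Q i) (Q j) (Q l) = 0 \<longleftrightarrow> bracket (P i) (P j) (P l) = 0"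
proof -
  obtain A where A: "invertible A" "\<forall>i. proj_eq (Q i) (A *v P i)"
    using assms unfolding proj_equiv_def by blast
  then obtain c where c: "\<And>i. c i \<noteq> 0" "\<And>i. Q i = c i *\<^sub>R (A *v P i)"
    unfolding proj_eq_def by metis
  have "bracket (A *v x) (A *v y) (A *v z) = det A * bracket x y z" for x y z
    by (simp add: bracket_expand det_3 matrix_vector_mult_def sum_3 algebra_simps)
  then show ?thesis
    using A(1) c(1) by (simp add: c(2) invertible_det_nz)
qed

section \<open>Passage to equivalence classes\<close>

text \<open>The existence of a monodromy is equivalence of the polygon with its shift by \<open>n\<close>. No
  nondegeneracy is required: at index \<open>i\<close> it follows from the brackets of an \<open>i\<close>-representative.\<close>

definition oriented_spiral_class :: "real \<Rightarrow> nat \<Rightarrow> nat \<Rightarrow> (int \<Rightarrow> real^3) \<Rightarrow> bool" where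
  "oriented_spiral_class s k n P \<longleftrightarrow> proj_equiv P (\<lambda>i. P (i + int n)) \<and>
     (\<forall>N. \<exists>V. proj_equiv P V \<and> oriented_spiral s k N V)"

lemma oriented_spiral_class_nondegenerate:
  assumes "oriented_spiral_class s k n P"
  shows "twisted_ngon n P" "k_nice k P"
proof -
  have nz: "bracket (P i) (P (i+1)) (P (i+2)) \<noteq> 0 \<and>
     bracket (P i) (P (i+1)) (P (i + int k)) \<noteq> 0 \<and>
     bracket (P i) (P (i+1)) (P (i + int k + 1)) \<noteq> 0 \<and>
     bracket (P (i+1)) (P (i + int k)) (P (i + int k + 1)) \<noteq> 0 \<and>
     bracket (P i) (P (i + int k)) (P (i + int k + 1)) \<noteq> 0" for i
  proof -
    obtain V where V: "proj_equiv P V" "oriented_spiral s k i V"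
      using assms unfolding oriented_spiral_class_def by blast
    show ?thesis
      using V(2) unfolding oriented_spiral_def proj_equiv_bracket[OF V(1), symmetric]
      by (metis less_irrefl mult_zero_right order_refl)
  qed
  have "bracket 0 v w = 0" for v w
    by (simp add: bracket_def)
  with nz have "P i \<noteq> 0" for i
    by metis
  with nz assms show "twisted_ngon n P"
    unfolding twisted_ngon_def oriented_spiral_class_def proj_equiv_def collinear3_bracket by blast
  show "k_nice k P"
    using nz unfolding k_nice_def gen_pos4_def collinear3_bracket by blast
qed

lemma spiral_iff:
  "spiral_alpha k n P \<longleftrightarrow> oriented_spiral_class 1 k n P"
  "spiral_beta k n P \<longleftrightarrow> oriented_spiral_class (-1) k n P"
proof -
  have tw: "twisted_ngon n P \<Longrightarrow> proj_equiv P (\<lambda>i. P (i + int n))"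
    unfolding twisted_ngon_def proj_equiv_def by blast
  have lift: "proj_equiv P Q \<Longrightarrow> proj_equiv P (affine_lift Q)" for Q
    using proj_equiv_rescale affine_lift_scale by blast
  show "spiral_alpha k n P \<longleftrightarrow> oriented_spiral_class 1 k n P"
  proof
    show "oriented_spiral_class 1 k n P" if "spiral_alpha k n P"
      using that tw lift N_rep_oriented_spiral(1)
      unfolding spiral_alpha_def oriented_spiral_class_def by fast
    show "spiral_alpha k n P" if *: "oriented_spiral_class 1 k n P"
      using * oriented_spiral_class_nondegenerate[OF *] oriented_spiral_N_rep(1)
      unfolding spiral_alpha_def oriented_spiral_class_def by fast
  qed
  show "spiral_beta k n P \<longleftrightarrow> oriented_spiral_class (-1) k n P"
  proof
    show "oriented_spiral_class (-1) k n P" if "spiral_beta k n P"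
      using that tw lift N_rep_oriented_spiral(2)
      unfolding spiral_beta_def oriented_spiral_class_def by fast
    show "spiral_beta k n P" if *: "oriented_spiral_class (-1) k n P"
      using * oriented_spiral_class_nondegenerate[OF *] oriented_spiral_N_rep(2)
      unfolding spiral_beta_def oriented_spiral_class_def by fast
  qed
qed

text \<open>\<open>Tk\<close> commutes with the shift by \<open>n\<close>, so equivariance carries
  over the monodromy as well as the representatives.\<close>

lemma oriented_spiral_class_Tk:
  assumes s: "s = 1 \<or> s = -1" and P: "oriented_spiral_class s k n P"
  shows "oriented_spiral_class s k n (Tk k P)"
  unfolding oriented_spiral_class_def
proof (intro conjI allI)
  have "Tk k (\<lambda>i. P (i + int n)) = (\<lambda>i. Tk k P (i + int n))"
    by (simp add: Tk_def add_ac)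
  then show "proj_equiv (Tk k P) (\<lambda>i. Tk k P (i + int n))"
    using P proj_equiv_Tk unfolding oriented_spiral_class_def by metis
  fix N
  obtain V where "proj_equiv P V" "oriented_spiral s k N V"
    using P unfolding oriented_spiral_class_def by blast
  then show "\<exists>W. proj_equiv (Tk k P) W \<and> oriented_spiral s k N W"
    using proj_equiv_Tk oriented_spiral_Tk[OF s] by blast
qed

lemma oriented_spiral_class_Tk_inv:
  assumes s: "s = 1 \<or> s = -1" and P: "oriented_spiral_class s k n P"
  shows "oriented_spiral_class s k n (Tk_inv k P)"
  unfolding oriented_spiral_class_def
proof (intro conjI allI)
  have "Tk_inv k (\<lambda>i. P (i + int n)) = (\<lambda>i. Tk_inv k P (i + int n))"
    by (simp add: Tk_inv_def algebra_simps)
  then show "proj_equiv (Tk_inv k P) (\<lambda>i. Tk_inv k P (i + int n))"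
    using P proj_equiv_Tk_inv unfolding oriented_spiral_class_def by metis
  fix N
  \<comment> \<open>Starting \<open>k + 1\<close> indices earlier compensates the shift of the bound
    under \<open>Tk_inv\<close>.\<close>
  obtain V where V: "proj_equiv P V" "oriented_spiral s k (N - int k - 1) V"
    using P unfolding oriented_spiral_class_def by blast
  have "proj_equiv (Tk_inv k P) (\<lambda>i. s *\<^sub>R Tk_inv k V i)"
    using proj_equiv_Tk_inv[OF V(1)] by (rule proj_equiv_rescale) (use s in \<open>auto intro: exI[of _ s]\<close>)
  moreover have "oriented_spiral s k N (\<lambda>i. s *\<^sub>R Tk_inv k V i)"
    using oriented_spiral_Tk_inv[OF s V(2)] by simp
  ultimately show "\<exists>W. proj_equiv (Tk_inv k P) W \<and> oriented_spiral s k N W"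
    by blast
qed

theorem mainTheorem1:
  fixes n k :: nat and P :: "int \<Rightarrow> real^3"
  assumes "n \<ge> 2" and "k \<ge> 3"
  shows "(spiral_alpha k n P \<longrightarrow> spiral_alpha k n (Tk k P) \<and> spiral_alpha k n (Tk_inv k P)) \<and>
         (spiral_beta k n P \<longrightarrow> spiral_beta k n (Tk k P) \<and> spiral_beta k n (Tk_inv k P))"
  by (simp add: spiral_iff oriented_spiral_class_Tk oriented_spiral_class_Tk_inv)

end
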